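(* Let $T$ be any finite tree with vertex set $V$. Call a subset of vertices $I\subset V$ infeasible if its Steiner tree $T(I)$ has two (distinct) leaves which are in $I$ and have the same parent; call all other subsets of $V$ feasible. Then the set $\mathcal M'(T)$ of feasible subsets is a delta-matroid with ground set $V$.
   Context: The Steiner tree $T(I)$ of a subset $I$ of vertices of a tree $T$ is the unique smallest sub-tree of $T$ containing $I$. The parent of a leaf of $T(I)$ is its unique neighbor in $T(I)$. A delta-matroid consists of a finite ground set $E$ and a nonempty family $\mathcal F\subset 2^E$ (the feasible subsets) such that (1) $\bigcup_{F\in\mathcal F}F=E$; and (2) (symmetric exchange axiom) for all $A,B\in\mathcal F$ and $x\in A\Delta B$ there exists $y\in A\Delta B$ (possibly $y=x$) such that $A\Delta\{x,y\}\in\mathcal F$, where $\Delta$ denotes symmetric difference. *)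

theory Defs
  imports "Graph_Theory.Digraph_Component"
begin

(* A finite simple undirected graph is a pair_graph: a symmetric loop-free set of arcs,
   each edge being represented by its two orientations.

   The constant Digraph_Component.tree does not describe undirected trees: its notion of
   cycle is the directed one, so traversing an edge back and forth is a cycle, while an
   acyclically oriented triangle has none.  In a pair_graph, the cycles in the usual sense
   are the directed cycles with at least three arcs.  The constant connected includes
   nonemptiness. *)
definition fin_tree :: "'a pair_pre_digraph \<Rightarrow> bool" where
  "fin_tree T \<longleftrightarrow> pair_graph T \<and> connected (with_proj T) \<and>
     \<not> (\<exists>p. pre_digraph.cycle (with_proj T) p \<and> 3 \<le> length p)"

definition subtree :: "'a pair_pre_digraph \<Rightarrow> 'a pair_pre_digraph \<Rightarrow> bool" where
  "subtree S T \<longleftrightarrow> subgraph (with_proj S) (with_proj T) \<and> fin_tree S"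

(* S is the smallest subtree of T containing I.  As trees are nonempty, the empty set has no
   Steiner tree in this sense once T has two vertices; this does not matter for feasibility,
   since infeasibility of I is witnessed by elements of I. *)
definition is_steiner_tree :: "'a pair_pre_digraph \<Rightarrow> 'a set \<Rightarrow> 'a pair_pre_digraph \<Rightarrow> bool" where
  "is_steiner_tree T I S \<longleftrightarrow> subtree S T \<and> I \<subseteq> pverts S \<and>
     (\<forall>S'. subtree S' T \<and> I \<subseteq> pverts S' \<longrightarrow> subgraph (with_proj S) (with_proj S'))"

(* Arcs come in both orientations, so the out-degree is the degree. *)
definition leaf :: "'a pair_pre_digraph \<Rightarrow> 'a \<Rightarrow> bool" where
  "leaf S v \<longleftrightarrow> v \<in> pverts S \<and> out_degree (with_proj S) v = 1"

definition parent :: "'a pair_pre_digraph \<Rightarrow> 'a \<Rightarrow> 'a" where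
  "parent S v = (THE w. v \<rightarrow>\<^bsub>with_proj S\<^esub> w)"

definition infeasible :: "'a pair_pre_digraph \<Rightarrow> 'a set \<Rightarrow> bool" where
  "infeasible T I \<longleftrightarrow> (\<exists>S. is_steiner_tree T I S \<and>
     (\<exists>u\<in>I. \<exists>v\<in>I. u \<noteq> v \<and> leaf S u \<and> leaf S v \<and> parent S u = parent S v))"

definition feasible_sets :: "'a pair_pre_digraph \<Rightarrow> 'a set set" where
  "feasible_sets T = {I. I \<subseteq> pverts T \<and> \<not> infeasible T I}"

definition delta_matroid :: "'a set \<Rightarrow> 'a set set \<Rightarrow> bool" where
  "delta_matroid E F \<longleftrightarrow> finite E \<and> F \<noteq> {} \<and> F \<subseteq> Pow E \<and> \<Union>F = E \<and>
     (\<forall>A\<in>F. \<forall>B\<in>F. \<forall>x\<in>sym_diff A B. \<exists>y\<in>sym_diff A B. sym_diff A {x, y} \<in> F)"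

end

theory Submission
  imports Defs
begin

text \<open>
  Removing a vertex \<open>w\<close> from a tree splits it into branches, one for each neighbour of \<open>w\<close>.
  Call a neighbour \<open>u\<close> of \<open>w\<close> pendant for a vertex set \<open>I\<close> if \<open>u\<close> is the only element of \<open>I\<close> in its
  branch.  A leaf of the Steiner tree of \<open>I\<close> with parent \<open>w\<close> is the same as a neighbour of \<open>w\<close>
  pendant for \<open>I\<close>, as soon as \<open>w\<close> lies in the Steiner tree; so \<open>I\<close> is infeasible iff some \<open>w\<close>
  has two pendant neighbours, here called twins (\<open>infeasible_iff_twins\<close>).  What remains is a
  statement about branches only.

  The exchange axiom for \<open>A\<close>, \<open>B\<close> and \<open>x\<close> is proved as follows.  Let \<open>I\<close> be \<open>A\<close> with the membership
  of \<open>x\<close> switched, so that \<open>I\<close> and \<open>B\<close> agree at \<open>x\<close>.  If \<open>I\<close> is twin-free, take \<open>y = x\<close>.  Otherwise: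

  \<^item> \<open>I\<close> has exactly one pair of twins \<open>u\<close>, \<open>v\<close> at one vertex \<open>w\<close> (\<open>twins_unique_after_toggle\<close>).
    Indeed, every pair of twins of \<open>I\<close> has \<open>x\<close> in one of its two branches, as \<open>A\<close> is twin-free.
    Branches of twins at different vertices are disjoint, and of three pendant neighbours at one
    vertex two are left untouched by \<open>x\<close>.
  \<^item> Deleting \<open>u\<close> from \<open>I\<close> destroys this pair and creates no other one
    (\<open>twin_free_remove_twin\<close>), and so does adding to \<open>I\<close> any further vertex of the branch of \<open>u\<close>
    (\<open>twin_free_insert_in_branch\<close>).  The same holds for \<open>v\<close>.

  As \<open>B\<close> is twin-free, \<open>B\<close> misses \<open>u\<close> or \<open>v\<close>, or contains a further vertex of one of their branches.
  That vertex is the required \<open>y\<close>: the sets \<open>I\<close> and \<open>B\<close> differ there, so it is not \<open>x\<close>, and \<open>A\<close> and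
  \<open>B\<close> differ there as well.
\<close>

section \<open>Branches of a tree\<close>

text \<open>
  Only adjacency matters for the combinatorial part, so a tree is taken as a symmetric relation.
  Acyclicity is stated in the form in which it is used: distinct neighbours of a vertex
  lie in different components once this vertex is removed.
\<close>

locale tree_relation =
  fixes V :: "'a set" and E :: "'a rel"
  assumes finite_V: "finite V"
    and edges_in_V: "E \<subseteq> V \<times> V"
    and sym_E: "sym E"
    and loopless: "(v, v) \<notin> E"
    and connected: "a \<in> V \<Longrightarrow> b \<in> V \<Longrightarrow> (a, b) \<in> E\<^sup>*"
    and acyclic: "(w, u) \<in> E \<Longrightarrow> (w, v) \<in> E \<Longrightarrow> (u, v) \<in> (E \<inter> (- {w}) \<times> (- {w}))\<^sup>* \<Longrightarrow> u = v"
begin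

definition same_side :: "'a \<Rightarrow> 'a \<Rightarrow> 'a \<Rightarrow> bool" where
  "same_side w a b \<longleftrightarrow> a \<noteq> w \<and> b \<noteq> w \<and> (a, b) \<in> (E \<inter> (- {w}) \<times> (- {w}))\<^sup>*"

lemma edge_sym: "(a, b) \<in> E \<Longrightarrow> (b, a) \<in> E"
  using sym_E by (auto dest: symD)

lemma edge_neq: "(a, b) \<in> E \<Longrightarrow> a \<noteq> b"
  using loopless by auto

lemma edge_in_V: "(a, b) \<in> E \<Longrightarrow> a \<in> V \<and> b \<in> V"
  using edges_in_V by auto

lemma same_side_neq: "same_side w a b \<Longrightarrow> a \<noteq> w \<and> b \<noteq> w"
  by (simp add: same_side_def)

lemma same_side_refl: "a \<noteq> w \<Longrightarrow> same_side w a a"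
  by (simp add: same_side_def)

lemma same_side_sym: "same_side w a b \<Longrightarrow> same_side w b a"
proof -
  have "sym (E \<inter> (- {w}) \<times> (- {w}))"
    using sym_E by (auto simp: sym_def)
  then have "sym ((E \<inter> (- {w}) \<times> (- {w}))\<^sup>*)"
    by (rule sym_rtrancl)
  then show "same_side w a b \<Longrightarrow> same_side w b a"
    by (auto simp: same_side_def dest: symD)
qed

lemma same_side_trans: "same_side w a b \<Longrightarrow> same_side w b c \<Longrightarrow> same_side w a c"
  by (auto simp: same_side_def)

lemma same_side_edge: "(a, b) \<in> E \<Longrightarrow> a \<noteq> w \<Longrightarrow> b \<noteq> w \<Longrightarrow> same_side w a b"
  by (auto simp: same_side_def)

lemma neighbours_apart: "(w, u) \<in> E \<Longrightarrow> (w, v) \<in> E \<Longrightarrow> same_side w u v \<Longrightarrow> u = v"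
  using acyclic by (auto simp: same_side_def)

text \<open>
  If \<open>z\<close> and \<open>w'\<close> lie in different branches at \<open>w\<close>, then the walk from \<open>z\<close> to \<open>w\<close> does not meet
  \<open>w'\<close>, so seen from \<open>w'\<close> the vertices \<open>z\<close> and \<open>w\<close> are in the same direction.  This is how
  information about the branches at one vertex is carried over to another vertex.
\<close>

lemma same_side_swap:
  assumes "w \<in> V" "z \<in> V" "w' \<noteq> w" "z \<noteq> w" "\<not> same_side w z w'"
  shows "same_side w' z w"
proof -
  have "(w, z) \<in> E\<^sup>*"
    using assms connected by blast
  then have "z \<noteq> w \<longrightarrow> \<not> same_side w z w' \<longrightarrow> same_side w' z w"
  proof (induction rule: rtrancl_induct)
    case base
    then show ?case by simp
  next
    case (step y z)
    show ?case
    proof (intro impI)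
      assume z: "z \<noteq> w" "\<not> same_side w z w'"
      then have zw': "z \<noteq> w'"
        using assms(3) same_side_refl by blast
      show "same_side w' z w"
      proof (cases "y = w")
        case True
        then show ?thesis
          using step.hyps edge_sym zw' assms(3) same_side_edge by metis
      next
        case False
        then have "same_side w z y"
          using step.hyps z edge_sym same_side_edge by metis
        then have "\<not> same_side w y w'"
          using z same_side_trans by blast
        then have "same_side w' y w"
          using step.IH False by blast
        then show ?thesis
          using step.hyps zw' edge_sym same_side_edge same_side_neq same_side_trans by metis
      qed
    qed
  qed
  then show ?thesis
    using assms by blast
qed

text \<open>
  A walk from \<open>z\<close> to \<open>a\<close> that avoids \<open>t\<close> leaves \<open>z\<close> for good through a neighbour other than \<open>t\<close>,
  hence ends in a branch at \<open>z\<close> other than the one of \<open>t\<close>.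
\<close>

lemma edge_separates:
  assumes "(z, t) \<in> E" "same_side z t a" "same_side t z a"
  shows False
proof -
  have "(z, a) \<in> (E \<inter> (- {t}) \<times> (- {t}))\<^sup>*"
    using assms(3) by (simp add: same_side_def)
  then have "a = z \<or> \<not> same_side z t a"
  proof (induction rule: rtrancl_induct)
    case base
    then show ?case by simp
  next
    case (step y a)
    show ?case
    proof (cases "y = z")
      case True
      then show ?thesis
        using step.hyps assms(1) neighbours_apart by blast
    next
      case False
      then show ?thesis
        using step edge_sym same_side_edge same_side_trans by blast
    qed
  qed
  then show False
    using assms(2) same_side_neq by blast
qed

lemma neighbour_towards:
  assumes "z \<in> V" "a \<in> V" "z \<noteq> a"
  obtains t where "(z, t) \<in> E" "same_side z t a"
proof -
  have "(z, a) \<in> E\<^sup>*"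
    using assms connected by blast
  then have "z \<noteq> a \<longrightarrow> (\<exists>t. (z, t) \<in> E \<and> same_side z t a)"
  proof (induction rule: rtrancl_induct)
    case base
    then show ?case by simp
  next
    case (step y a)
    show ?case
    proof (cases "y = z")
      case True
      then show ?thesis
        using step.hyps same_side_refl[of a z] by auto
    next
      case False
      then show ?thesis
        using step same_side_edge[of y a z] same_side_trans same_side_refl by metis
    qed
  qed
  then show thesis
    using assms(3) that by blast
qed

section \<open>Pendant vertices and twins\<close>

definition pendant :: "'a set \<Rightarrow> 'a \<Rightarrow> 'a \<Rightarrow> bool" where
  "pendant I w u \<longleftrightarrow> (w, u) \<in> E \<and> u \<in> I \<and> (\<forall>z\<in>I. same_side w u z \<longrightarrow> z = u)"

definition twins :: "'a set \<Rightarrow> 'a \<Rightarrow> 'a \<Rightarrow> 'a \<Rightarrow> bool" where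
  "twins I w u v \<longleftrightarrow> u \<noteq> v \<and> pendant I w u \<and> pendant I w v"

definition twin_free :: "'a set \<Rightarrow> bool" where
  "twin_free I \<longleftrightarrow> (\<nexists>w u v. twins I w u v)"

lemma twins_commute: "twins I w u v \<Longrightarrow> twins I w v u"
  by (auto simp: twins_def)

lemma pendant_subset: "pendant J w u \<Longrightarrow> u \<in> I \<Longrightarrow> I \<subseteq> J \<Longrightarrow> pendant I w u"
  by (auto simp: pendant_def)

lemma pendant_toggle:
  assumes "pendant (sym_diff I {x}) w u" "\<not> same_side w u x"
  shows "pendant I w u"
proof -
  have "u \<noteq> x"
    using assms same_side_refl edge_neq unfolding pendant_def by metis
  then show ?thesis
    using assms unfolding pendant_def by auto
qed

text \<open>
  Suppose that \<open>w'\<close> is in the branch of \<open>u\<close> at \<open>w\<close>.  All neighbours of \<open>w'\<close> except possibly \<open>w\<close> are then in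
  this branch too, whose only element of \<open>I\<close> is \<open>u\<close>.  So the twins at \<open>w'\<close> must be \<open>w\<close> and \<open>u\<close>, but these
  are adjacent and cannot lie in different branches at \<open>w'\<close>.
\<close>

lemma twins_hub_not_in_branch:
  assumes t: "twins I w u v" and t': "twins I w' u' v'" and neq: "w \<noteq> w'"
  shows "\<not> same_side w u w'"
proof
  assume s: "same_side w u w'"
  have branch: "c = u" if "pendant I w' c" "c \<noteq> w" for c
    using that s t neq same_side_edge[of w' c w] same_side_trans[of w u w' c]
    unfolding twins_def pendant_def by metis
  have "w \<in> {u', v'}" "u \<in> {u', v'}"
    using branch[of u'] branch[of v'] t' unfolding twins_def by auto
  then have p: "pendant I w' w" "pendant I w' u"
    using t' unfolding twins_def by auto
  have "same_side w' w u"
    using t p neq same_side_edge[of w u w'] edge_neq unfolding twins_def pendant_def by metis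
  then show False
    using p t edge_neq neighbours_apart[of w' w u] unfolding twins_def pendant_def by metis
qed

lemma toggle_meets_all_twins:
  assumes "twin_free A" "twins (sym_diff A {x}) w u v"
  shows "same_side w u x \<or> same_side w v x"
  using assms pendant_toggle unfolding twin_free_def twins_def by blast

text \<open>
  If the twins sit at different vertices \<open>w\<close> and \<open>w'\<close>, neither vertex is in a branch belonging to the
  other pair.  The vertex \<open>x\<close> lies in a branch of each pair; seen from \<open>w'\<close>, it is in the direction of
  \<open>w\<close>, which puts \<open>w\<close> in a forbidden branch.  If the twins sit at the same vertex, at most one
  neighbour of it became pendant by the switch, and at most one was pendant before.
\<close>

lemma twins_unique_after_toggle:
  assumes A: "twin_free A" and x: "x \<in> V"
    and t: "twins (sym_diff A {x}) w u v" and t': "twins (sym_diff A {x}) w' u' v'"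
  shows "w = w' \<and> {u, v} = {u', v'}"
proof -
  let ?I = "sym_diff A {x}"
  have "w = w'" if s: "same_side w u x" and s': "same_side w' u' x"
    and t: "twins ?I w u v" and t': "twins ?I w' u' v'" for u v u' v'
  proof (rule ccontr)
    assume neq: "w \<noteq> w'"
    have far: "\<not> same_side w u w'" "\<not> same_side w' u' w"
      using twins_hub_not_in_branch[OF t t' neq] twins_hub_not_in_branch[OF t' t] neq by auto
    have "w \<in> V" "w' \<in> V"
      using t t' edge_in_V unfolding twins_def pendant_def by metis+
    moreover have "x \<noteq> w"
      using s same_side_neq by blast
    moreover have "\<not> same_side w x w'"
      using s far same_side_trans by blast
    ultimately have "same_side w' x w"
      using same_side_swap[of w x w'] x neq by auto
    then show False
      using far s' same_side_trans by blast
  qed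
  then have w: "w = w'"
    using toggle_meets_all_twins[OF A t] toggle_meets_all_twins[OF A t'] t t' twins_commute
    by metis
  have rest: "c = u" if "same_side w u x" "pendant ?I w c" "\<not> pendant A w c"
    "pendant ?I w u" for c u
  proof -
    have "same_side w c x"
      using that pendant_toggle by blast
    then have "same_side w c u"
      using that same_side_trans same_side_sym by blast
    then show ?thesis
      using that neighbours_apart unfolding pendant_def by blast
  qed
  have at_most_one: "c = d" if "pendant A w c" "pendant A w d" for c d
    using that A unfolding twin_free_def twins_def by blast
  have "{u, v} = {u', v'}"
  proof -
    have new: "c = d" if "pendant ?I w c" "pendant ?I w d" "\<not> pendant A w c" "\<not> pendant A w d"
      for c d
      using that rest pendant_toggle by metis
    show ?thesis
      using t t' w new at_most_one unfolding twins_def by (metis (full_types) insert_commute)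
  qed
  with w show ?thesis
    by simp
qed

text \<open>
  If \<open>q\<close> becomes pendant at some \<open>p\<close> by the removal of \<open>u\<close>, its branch contained \<open>u\<close>, hence also \<open>w\<close>.
  Either \<open>p = v\<close>, or the branch contains \<open>v\<close> as well, which forces \<open>q = v\<close>.  In both cases every
  neighbour of \<open>p\<close> other than \<open>q\<close> is in the branch of \<open>v\<close> at \<open>w\<close>, where \<open>I\<close> has no element besides \<open>v\<close>.
  So \<open>q\<close> cannot have a twin.
\<close>

lemma twin_free_remove_twin:
  assumes t: "twins I w u v"
    and unique: "\<And>p q r. twins I p q r \<Longrightarrow> p = w \<and> {q, r} = {u, v}"
  shows "twin_free (I - {u})"
proof -
  have no_new: False if q: "pendant (I - {u}) p q" and r: "pendant (I - {u}) p r" "q \<noteq> r"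
    and u: "same_side p q u" for p q r
  proof -
    have wu: "(w, u) \<in> E" "u \<in> I" and wv: "(w, v) \<in> E" "v \<in> I" "u \<noteq> v"
      using t unfolding twins_def pendant_def by auto
    have pq: "(p, q) \<in> E" "q \<in> I" "q \<noteq> u" and pr: "(p, r) \<in> E" "r \<in> I" "r \<noteq> u"
      using q r unfolding pendant_def by auto
    have v_branch: "z = v" if "z \<in> I" "same_side w v z" for z
      using that t unfolding twins_def pendant_def by blast
    have pu: "p \<noteq> u"
      using u same_side_neq by blast
    have pw: "p \<noteq> w"
      using pq u wu neighbours_apart by metis
    then have qw: "same_side p q w"
      using u pu wu same_side_edge[of u w p] edge_sym same_side_trans by metis
    have rw: "r \<noteq> w"
      using qw pq pr r(2) neighbours_apart by metis
    show False
    proof (cases "v = p")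
      case True
      then have "same_side w v r"
        using pr pw rw same_side_edge by metis
      then show False
        using v_branch pr True edge_neq by metis
    next
      case False
      have "same_side p q v"
        using qw False pw wv same_side_edge same_side_trans by metis
      then have "q = v"
        using q wv unfolding pendant_def by auto
      have "same_side w v p" "same_side w p r"
        using \<open>q = v\<close> pq pr pw rw wv same_side_edge edge_sym edge_neq by metis+
      then have "r = v"
        using v_branch pr same_side_trans by metis
      then show False
        using r(2) \<open>q = v\<close> by simp
    qed
  qed
  have "pendant I p q" if "twins (I - {u}) p q r" for p q r
    using that no_new[of p q r] unfolding twins_def pendant_def by auto
  then have "twins I p q r" if "twins (I - {u}) p q r" for p q r
    using that twins_commute unfolding twins_def by blast
  moreover have "u \<notin> {q, r}" if "twins (I - {u}) p q r" for p q r
    using that unfolding twins_def pendant_def by blast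
  ultimately show ?thesis
    using unique unfolding twin_free_def by blast
qed

text \<open>
  Since \<open>y\<close> is not a neighbour of \<open>w\<close>, any \<open>p\<close> at which \<open>y\<close> becomes pendant is in the branch of \<open>u\<close> at \<open>w\<close>.
  A twin of \<open>y\<close> at \<open>p\<close> could then only be \<open>u\<close> or \<open>w\<close>, but their branch at \<open>p\<close> contains \<open>v\<close>.
  Adding an element makes no other vertex pendant, and \<open>u\<close> stops being pendant at \<open>w\<close>.
\<close>

lemma twin_free_insert_in_branch:
  assumes t: "twins I w u v" and y: "same_side w u y" "y \<noteq> u"
    and unique: "\<And>p q r. twins I p q r \<Longrightarrow> p = w \<and> {q, r} = {u, v}"
  shows "twin_free (insert y I)"
proof -
  let ?J = "insert y I"
  have wu: "(w, u) \<in> E" "u \<in> I" and wv: "(w, v) \<in> E" "v \<in> I" "u \<noteq> v"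
    using t unfolding twins_def pendant_def by auto
  have u_branch: "z = u" if "z \<in> I" "same_side w u z" for z
    using that t unfolding twins_def pendant_def by blast
  have no_new: False if q: "pendant ?J p y" and r: "pendant ?J p r" "r \<noteq> y" for p r
  proof -
    have py: "(p, y) \<in> E" and pr: "(p, r) \<in> E" "r \<in> I"
      using q r unfolding pendant_def by auto
    have pw: "p \<noteq> w"
      using py wu y neighbours_apart by metis
    have up: "same_side w u p"
      using y pw py same_side_edge[of y p w] same_side_trans edge_sym same_side_neq by metis
    have "\<not> same_side w u v"
      using wu wv neighbours_apart by metis
    then have "same_side p v w" and vp: "v \<noteq> p"
      using same_side_swap[of w v p] wv pw up edge_in_V edge_neq same_side_trans same_side_sym
      by metis+
    show False
    proof (cases "r = w")
      case True
      then have "v = r"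
        using \<open>same_side p v w\<close> r wv same_side_sym unfolding pendant_def by blast
      then show False
        using True wv edge_neq by metis
    next
      case False
      then have "r = u"
        using u_branch up pr pw same_side_edge same_side_trans by metis
      have "same_side p u w"
        using \<open>r = u\<close> pr pw wu same_side_edge edge_sym edge_neq by metis
      then have "same_side p u v"
        using \<open>same_side p v w\<close> same_side_trans same_side_sym by blast
      then show False
        using \<open>r = u\<close> r wv unfolding pendant_def by auto
    qed
  qed
  have old: "twins I p q r" if J: "twins ?J p q r" for p q r
  proof -
    have "q \<noteq> y" "r \<noteq> y"
      using J no_new[of p r] no_new[of p q] unfolding twins_def by auto
    moreover have "q \<in> ?J" "r \<in> ?J"
      using J unfolding twins_def pendant_def by auto
    ultimately show "twins I p q r"
      using J pendant_subset[of ?J p q I] pendant_subset[of ?J p r I] unfolding twins_def by auto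
  qed
  have lost: "\<not> pendant ?J w u"
    using y unfolding pendant_def by auto
  have False if J: "twins ?J p q r" for p q r
  proof -
    have "p = w" "u = q \<or> u = r"
      using unique[OF old[OF J]] by auto
    then show False
      using lost J unfolding twins_def by auto
  qed
  then show ?thesis
    unfolding twin_free_def by blast
qed

lemma twin_free_exchange:
  assumes A: "A \<subseteq> V" "twin_free A" and B: "B \<subseteq> V" "twin_free B" and x: "x \<in> sym_diff A B"
  shows "\<exists>y\<in>sym_diff A B. twin_free (sym_diff A {x, y})"
proof (cases "twin_free (sym_diff A {x})")
  case True
  then show ?thesis
    using x by (intro bexI[of _ x]) auto
next
  case False
  let ?I = "sym_diff A {x}"
  have xI: "x \<in> ?I \<longleftrightarrow> x \<in> B"
    using x by auto
  have xV: "x \<in> V"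
    using A B x by auto
  obtain w u v where t: "twins ?I w u v"
    using False unfolding twin_free_def by blast
  \<comment> \<open>Since \<^term>\<open>u\<close> and \<^term>\<open>v\<close> play symmetric roles, the two possible moves are prepared
     for either order of the pair.\<close>
  have unique: "p = w \<and> {q, r} = {u, v}" if "twins ?I p q r" for p q r
    using twins_unique_after_toggle[OF A(2) xV that t] by simp
  have remove_twin: ?thesis if t: "twins ?I w u v" "u \<notin> B"
    and unique: "\<And>p q r. twins ?I p q r \<Longrightarrow> p = w \<and> {q, r} = {u, v}" for u v
  proof -
    have "u \<in> ?I" "u \<noteq> x"
      using t xI unfolding twins_def pendant_def by auto
    then have "u \<in> sym_diff A B" "sym_diff A {x, u} = ?I - {u}"
      using that by auto
    then show ?thesis
      using twin_free_remove_twin[OF t(1) unique] by metis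
  qed
  have insert_in_branch: ?thesis if t: "twins ?I w u v" and y: "y \<in> B" "same_side w u y" "y \<noteq> u"
    and unique: "\<And>p q r. twins ?I p q r \<Longrightarrow> p = w \<and> {q, r} = {u, v}" for u v y
  proof -
    have "y \<notin> ?I"
      using t y unfolding twins_def pendant_def by blast
    then have "y \<in> sym_diff A B" "sym_diff A {x, y} = insert y ?I"
      using y xI by auto
    moreover have "twin_free (insert y ?I)"
      using twin_free_insert_in_branch[OF t y(2,3) unique] by blast
    ultimately show ?thesis
      by metis
  qed
  have t': "twins ?I w v u"
    using t by (rule twins_commute)
  have unique': "p = w \<and> {q, r} = {v, u}" if "twins ?I p q r" for p q r
    using unique[OF that] by auto
  consider "u \<notin> B" | "v \<notin> B" | "u \<in> B" "v \<in> B"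
    by blast
  then show ?thesis
  proof cases
    case 1
    then show ?thesis using remove_twin[OF t _ unique] by blast
  next
    case 2
    then show ?thesis using remove_twin[OF t' _ unique'] by blast
  next
    case 3
    have "\<not> pendant B w u \<or> \<not> pendant B w v"
      using B t unfolding twin_free_def twins_def by blast
    then consider y where "y \<in> B" "same_side w u y" "y \<noteq> u"
      | y where "y \<in> B" "same_side w v y" "y \<noteq> v"
      using 3 t unfolding twins_def pendant_def by blast
    then show ?thesis
    proof cases
      case 1
      then show ?thesis using insert_in_branch[OF t _ _ _ unique] by blast
    next
      case 2
      then show ?thesis using insert_in_branch[OF t' _ _ _ unique'] by blast
    qed
  qed
qed

section \<open>Steiner trees\<close>

text \<open>
  The vertices of the Steiner tree of a nonempty set: the elements of \<open>I\<close> and the vertices separating two of them.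
\<close>

definition steiner_verts :: "'a set \<Rightarrow> 'a set" where
  "steiner_verts I = {z \<in> V. z \<in> I \<or> (\<exists>a\<in>I. \<exists>b\<in>I. a \<noteq> z \<and> b \<noteq> z \<and> \<not> same_side z a b)}"

text \<open>
  Moving from a vertex of the Steiner tree one step towards \<open>a\<close> stays inside it: the new vertex \<open>t\<close>
  separates \<open>z\<close> from \<open>a\<close>.  If \<open>z\<close> is not in \<open>I\<close>, some \<open>d\<close> in \<open>I\<close> lies in a branch at \<open>z\<close> not
  containing \<open>a\<close>, and \<open>t\<close> separates this \<open>d\<close> from \<open>a\<close> as well.
\<close>

lemma steiner_verts_step:
  assumes I: "I \<subseteq> V" and a: "a \<in> I" and z: "z \<in> steiner_verts I" and t: "(z, t) \<in> E" "same_side z t a"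
  shows "t \<in> steiner_verts I"
proof (cases "t = a")
  case True
  then show ?thesis
    using a I by (auto simp: steiner_verts_def)
next
  case False
  have zV: "z \<in> V" "t \<in> V" "z \<noteq> t"
    using t edge_in_V edge_neq by blast+
  have sep: "\<not> same_side t z a"
    using edge_separates t by blast
  have "\<exists>b\<in>I. b \<noteq> t \<and> \<not> same_side t b a" if "t \<notin> I"
  proof (cases "z \<in> I")
    case True
    then show ?thesis
      using sep zV by blast
  next
    case False
    then obtain b c where bc: "b \<in> I" "c \<in> I" "b \<noteq> z" "c \<noteq> z" "\<not> same_side z b c"
      using z by (auto simp: steiner_verts_def)
    then obtain d where d: "d \<in> I" "d \<noteq> z" "\<not> same_side z d a"
      using same_side_trans same_side_sym by blast
    then have "same_side t d z"
      using same_side_swap[of z d t] t zV I same_side_trans by blast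
    then show ?thesis
      using d sep same_side_trans same_side_sym same_side_neq by blast
  qed
  then have "t \<in> I \<or> (\<exists>b\<in>I. b \<noteq> t \<and> a \<noteq> t \<and> \<not> same_side t b a)"
    using False by blast
  then show ?thesis
    using zV a unfolding steiner_verts_def by blast
qed

text \<open>
  Walking towards \<open>a\<close> terminates because the branch containing \<open>a\<close> shrinks with every step.
\<close>

lemma steiner_verts_connected_to:
  assumes I: "I \<subseteq> V" and a: "a \<in> I" and z: "z \<in> steiner_verts I"
  shows "(z, a) \<in> (E \<inter> steiner_verts I \<times> steiner_verts I)\<^sup>*"
  using z
proof (induction "card {c \<in> V. same_side z c a}" arbitrary: z rule: less_induct)
  case less
  show ?case
  proof (cases "z = a")
    case True
    then show ?thesis by simp
  next
    case False
    have aV: "a \<in> V" and zV: "z \<in> V"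
      using I a less.prems by (auto simp: steiner_verts_def)
    then obtain t where t: "(z, t) \<in> E" "same_side z t a"
      using False neighbour_towards by blast
    have tV: "t \<in> V" "z \<noteq> t"
      using t edge_in_V edge_neq by blast+
    have tH: "t \<in> steiner_verts I"
      using steiner_verts_step[OF I a less.prems t] .
    have sep: "\<not> same_side t z a"
      using edge_separates t by blast
    have "{c \<in> V. same_side t c a} \<subset> {c \<in> V. same_side z c a}"
    proof
      show "{c \<in> V. same_side t c a} \<subseteq> {c \<in> V. same_side z c a}"
      proof safe
        fix c assume c: "c \<in> V" "same_side t c a"
        then have "\<not> same_side t c z"
          using sep same_side_trans same_side_sym by blast
        then have "same_side z c t"
          using same_side_swap[of t c z] c tV same_side_neq by blast
        then show "same_side z c a"
          using t same_side_trans by blast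
      qed
      have "t \<in> {c \<in> V. same_side z c a}" "t \<notin> {c \<in> V. same_side t c a}"
        using t tV same_side_neq by blast+
      then show "{c \<in> V. same_side t c a} \<noteq> {c \<in> V. same_side z c a}"
        by blast
    qed
    then have "card {c \<in> V. same_side t c a} < card {c \<in> V. same_side z c a}"
      using finite_V by (intro psubset_card_mono) auto
    then have "(t, a) \<in> (E \<inter> steiner_verts I \<times> steiner_verts I)\<^sup>*"
      using less.hyps tH by blast
    then show ?thesis
      using t tH less.prems by (meson IntI SigmaI converse_rtrancl_into_rtrancl)
  qed
qed

lemma steiner_verts_connected:
  assumes I: "I \<subseteq> V" "I \<noteq> {}" and "y \<in> steiner_verts I" "z \<in> steiner_verts I"
  shows "(y, z) \<in> (E \<inter> steiner_verts I \<times> steiner_verts I)\<^sup>*"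
proof -
  obtain a where a: "a \<in> I"
    using I by blast
  have "sym (E \<inter> steiner_verts I \<times> steiner_verts I)"
    using sym_E by (auto simp: sym_def)
  then have "sym ((E \<inter> steiner_verts I \<times> steiner_verts I)\<^sup>*)"
    by (rule sym_rtrancl)
  then show ?thesis
    using steiner_verts_connected_to[OF I(1) a] assms(3,4) by (meson rtrancl_trans symD)
qed

text \<open>
  A subtree containing \<open>I\<close> joins any two elements of \<open>I\<close>, hence contains each vertex separating
  them.  It is an induced subgraph, as its own walk between the ends of an edge
  must start with that edge by acyclicity.
\<close>

lemma steiner_verts_least:
  assumes S: "tree_relation W F" "W \<subseteq> V" "F \<subseteq> E" and I: "I \<subseteq> W"
  shows "steiner_verts I \<subseteq> W" "E \<inter> steiner_verts I \<times> steiner_verts I \<subseteq> F"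
proof -
  interpret S: tree_relation W F by fact
  have same: "same_side z a b" if "S.same_side z a b" for z a b
  proof -
    have "F \<inter> (- {z}) \<times> (- {z}) \<subseteq> E \<inter> (- {z}) \<times> (- {z})"
      using S(3) by auto
    then show ?thesis
      using that rtrancl_mono unfolding S.same_side_def same_side_def by blast
  qed
  show sub: "steiner_verts I \<subseteq> W"
  proof
    fix z assume z: "z \<in> steiner_verts I"
    show "z \<in> W"
    proof (rule ccontr)
      assume "z \<notin> W"
      then have F: "F \<subseteq> E \<inter> (- {z}) \<times> (- {z})"
        using S.edges_in_V S(3) by auto
      obtain a b where ab: "a \<in> I" "b \<in> I" "a \<noteq> z" "b \<noteq> z" "\<not> same_side z a b"
        using z I \<open>z \<notin> W\<close> by (auto simp: steiner_verts_def)
      then have "(a, b) \<in> F\<^sup>*"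
        using S.connected I by blast
      then show False
        using ab rtrancl_mono[OF F] unfolding same_side_def by blast
    qed
  qed
  show "E \<inter> steiner_verts I \<times> steiner_verts I \<subseteq> F"
  proof safe
    fix p q assume pq: "(p, q) \<in> E" "p \<in> steiner_verts I" "q \<in> steiner_verts I"
    then obtain t where "(p, t) \<in> F" "S.same_side p t q"
      using S.neighbour_towards[of p q] sub edge_neq by blast
    then show "(p, q) \<in> F"
      using same pq S(3) neighbours_apart by blast
  qed
qed

text \<open>
  A further neighbour \<open>t\<close> of \<open>u\<close> is in the branch of \<open>u\<close> at \<open>w\<close>.  All of \<open>I\<close> then lies on the side of
  \<open>u\<close> as seen from \<open>t\<close>, so \<open>t\<close> neither belongs to \<open>I\<close> nor separates two elements of \<open>I\<close>.
\<close>

lemma pendant_leaf_of_steiner_verts: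
  assumes I: "I \<subseteq> V" and p: "pendant I w u" and t: "(u, t) \<in> E" "t \<in> steiner_verts I"
  shows "t = w"
proof (rule ccontr)
  assume tw: "t \<noteq> w"
  have wu: "(w, u) \<in> E" "w \<in> V" "t \<in> V" "u \<noteq> t"
    using p t edge_in_V edge_neq unfolding pendant_def by blast+
  have ut: "same_side w u t"
    using same_side_edge[OF t(1)] tw edge_neq[OF wu(1)] by metis
  then have "t \<notin> I"
    using p wu unfolding pendant_def by blast
  have "same_side t c u" if c: "c \<in> I" "c \<noteq> t" for c
  proof -
    have wut: "same_side t w u"
      using same_side_edge[OF wu(1)] tw wu by metis
    show ?thesis
    proof (cases "c = w \<or> c = u")
      case True
      then show ?thesis
        using wut wu same_side_refl by blast
    next
      case False
      then have "\<not> same_side w u c"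
        using p c unfolding pendant_def by blast
      then have "\<not> same_side w c t"
        using ut same_side_trans same_side_sym by blast
      then have "same_side t c w"
        using same_side_swap[of w c t] wu c tw False I by blast
      then show ?thesis
        using wut same_side_trans by blast
    qed
  qed
  then show False
    using t(2) \<open>t \<notin> I\<close> same_side_trans same_side_sym unfolding steiner_verts_def by blast
qed

lemma twins_hub_in_steiner_verts:
  assumes "twins I w u v"
  shows "w \<in> steiner_verts I"
proof -
  have "(w, u) \<in> E" "(w, v) \<in> E" "u \<in> I" "v \<in> I" "u \<noteq> v"
    using assms unfolding twins_def pendant_def by auto
  then have "w \<in> V" "u \<noteq> w" "v \<noteq> w" "\<not> same_side w u v"
    using neighbours_apart[of w u v] edge_neq[of w u] edge_neq[of w v] edge_in_V[of w u] by auto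
  then show ?thesis
    using \<open>u \<in> I\<close> \<open>v \<in> I\<close> unfolding steiner_verts_def by blast
qed

text \<open>
  Inside the subtree, a walk from \<open>w\<close> to another element of \<open>I\<close> cannot pass through the leaf \<open>u\<close>, so it never
  enters the branch of \<open>u\<close>.
\<close>

lemma leaf_of_subtree_pendant:
  assumes S: "tree_relation W F" "F \<subseteq> E" and I: "I \<subseteq> W" and u: "u \<in> I" "(u, w) \<in> F"
    and leaf: "\<And>t. (u, t) \<in> F \<Longrightarrow> t = w"
  shows "pendant I w u"
proof -
  interpret S: tree_relation W F by fact
  have wu: "(w, u) \<in> E" "w \<in> W"
    using u S(2) edge_sym S.edge_in_V by blast+
  have "z = u" if z: "z \<in> I" "same_side w u z" for z
  proof -
    have "(w, z) \<in> F\<^sup>*"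
      using S.connected wu z I by blast
    then have "z = w \<or> z = u \<or> \<not> same_side w u z"
    proof (induction rule: rtrancl_induct)
      case base
      then show ?case by simp
    next
      case (step y z)
      have yz: "(y, z) \<in> E"
        using step.hyps S(2) by blast
      show ?case
      proof (cases "y = w \<or> y = u")
        case True
        then show ?thesis
          using step.hyps yz wu leaf neighbours_apart by blast
      next
        case False
        then show ?thesis
          using step.IH yz same_side_edge[of z y w] edge_sym same_side_trans by blast
      qed
    qed
    then show ?thesis
      using z same_side_neq by blast
  qed
  then show ?thesis
    using wu u unfolding pendant_def by blast
qed

end

section \<open>Infeasible sets are the sets with twins\<close>

text \<open>
  Two neighbours of \<open>w\<close> joined by a path avoiding \<open>w\<close> would close up, through \<open>w\<close>, to a cycle with at least three arcs.
\<close>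

lemma fin_tree_imp_tree_relation:
  assumes "fin_tree T"
  shows "tree_relation (pverts T) (parcs T)"
proof -
  interpret pair_graph T
    using assms by (simp add: fin_tree_def)
  have sym: "sym (parcs T)"
    using pair_sym_arcs by (simp add: symmetric_def)
  show ?thesis
  proof
    show "finite (pverts T)" by (rule pair_finite_verts)
    show "parcs T \<subseteq> pverts T \<times> pverts T"
      using arc_fst_in_verts arc_snd_in_verts by fastforce
    show "sym (parcs T)" by (rule sym)
    show "(v, v) \<notin> parcs T" for v
      using pair_no_loops by fastforce
    show "(a, b) \<in> (parcs T)\<^sup>*" if "a \<in> pverts T" "b \<in> pverts T" for a b
    proof -
      have "connected (with_proj T)"
        using assms by (simp add: fin_tree_def)
      then have "a \<rightarrow>\<^sup>*\<^bsub>mk_symmetric T\<^esub> b"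
        using that unfolding connected_def strongly_connected_def by (simp add: mk_symmetric_def)
      then have "a \<rightarrow>\<^sup>*\<^bsub>T\<^esub> b"
        using reachable_mk_symmetric_eq[OF pair_sym_arcs] by simp
      then show ?thesis
        using rtrancl_on_rtranclI[of a b "pverts T" "parcs T"] by (simp add: reachable_def)
    qed
  next
    fix w u v
    assume wu: "(w, u) \<in> parcs T" and wv: "(w, v) \<in> parcs T"
      and path: "(u, v) \<in> (parcs T \<inter> (- {w}) \<times> (- {w}))\<^sup>*"
    show "u = v"
    proof (rule ccontr)
      assume "u \<noteq> v"
      define H where "H = \<lparr>pverts = pverts T - {w}, parcs = parcs T \<inter> (- {w}) \<times> (- {w})\<rparr>"
      interpret H: pair_wf_digraph H
        using arc_fst_in_verts arc_snd_in_verts unfolding H_def by unfold_locales auto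
      have sub: "subgraph H T"
        by (rule subgraphI) (auto simp: H_def compatible_def intro: H.wf_digraph[unfolded H_def] wf_digraph)
      have "u \<noteq> w"
        using wu pair_no_loops by fastforce
      then have uH: "u \<in> pverts H"
        using wu arc_snd_in_verts unfolding H_def by fastforce
      have "u \<rightarrow>\<^sup>*\<^bsub>H\<^esub> v"
        using path uH
      proof (induction rule: rtrancl_induct)
        case base
        then show ?case by (simp add: H.reachable_refl)
      next
        case (step y z)
        then show ?case
          using H.reachable_adj_trans[of u y z] by (simp add: H_def)
      qed
      then obtain p where p: "H.apath u p v"
        using H.reachable_apath by blast
      then have walk: "awalk u p v" and dist: "distinct (pawalk_verts u p)"
        using subgraph_apath_imp_apath[OF _ sub] by (auto simp: apath_def)
      have w: "w \<notin> set (pawalk_verts u p)"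
        using H.awalkI_apath[OF p] by (elim H.awalkE) (auto simp: H_def)
      have "p \<noteq> []"
        using walk \<open>u \<noteq> v\<close> by (auto simp: awalk_Nil_iff)
      let ?c = "(w, u) # p @ [(v, w)]"
      have "(v, w) \<in> parcs T"
        using wv sym by (auto dest: symD)
      then have "awalk v [(v, w)] w"
        using arc_implies_awalk by fastforce
      then have closing: "awalk u (p @ [(v, w)]) w"
        by (rule awalk_appendI[OF walk])
      then have "awalk w ?c w"
        using wu by (auto simp: awalk_Cons_iff)
      moreover have "pawalk_verts u (p @ [(v, w)]) = pawalk_verts u p @ [w]"
        using awalk_verts_append[OF closing] walk by (auto elim: awalkE)
      ultimately have "cycle ?c"
        using dist w unfolding cycle_def by (intro exI[of _ w]) simp
      moreover have "3 \<le> length ?c"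
        using \<open>p \<noteq> []\<close> by (cases p) auto
      ultimately show False
        using assms by (auto simp: fin_tree_def)
    qed
  qed
qed

lemma subtree_D:
  assumes "subtree S T"
  shows "tree_relation (pverts S) (parcs S)" "pverts S \<subseteq> pverts T" "parcs S \<subseteq> parcs T"
  using assms fin_tree_imp_tree_relation by (auto simp: subtree_def subgraph_def)

lemma leaf_parent:
  assumes "leaf S u"
  shows "(u, parent S u) \<in> parcs S" "(u, t) \<in> parcs S \<Longrightarrow> t = parent S u"
proof -
  obtain e where e: "{e \<in> parcs S. fst e = u} = {e}"
    using assms unfolding leaf_def out_degree_def out_arcs_def by (auto simp: card_1_singleton_iff)
  then have e': "e = (u, snd e)" "e \<in> parcs S"
    by (metis (mono_tags, lifting) mem_Collect_eq prod.collapse singletonI)+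
  have only: "t = snd e" if "(u, t) \<in> parcs S" for t
  proof -
    have "(u, t) \<in> {e \<in> parcs S. fst e = u}"
      using that by simp
    then have "(u, t) = e"
      unfolding e by simp
    then show ?thesis
      by auto
  qed
  have arc: "(u, snd e) \<in> parcs S"
    using e' by simp
  then have parent: "parent S u = snd e"
    using only unfolding parent_def with_proj_simps by (rule the_equality)
  show "(u, parent S u) \<in> parcs S"
    unfolding parent by (rule arc)
  show "t = parent S u" if "(u, t) \<in> parcs S"
    unfolding parent by (rule only[OF that])
qed

lemma leafI:
  assumes "u \<in> pverts S" "(u, w) \<in> parcs S" "\<And>t. (u, t) \<in> parcs S \<Longrightarrow> t = w"
  shows "leaf S u" "parent S u = w"
proof -
  have "{e \<in> parcs S. fst e = u} = {(u, w)}"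
    using assms(2) by (auto dest: assms(3))
  then show "leaf S u"
    using assms(1) by (simp add: leaf_def out_degree_def out_arcs_def)
  show "parent S u = w"
    using assms(2,3) unfolding parent_def with_proj_simps by (rule the_equality)
qed

lemma induced_steiner_verts_is_steiner_tree:
  assumes T: "fin_tree T" and I: "I \<subseteq> pverts T" "I \<noteq> {}"
  defines "W \<equiv> tree_relation.steiner_verts (pverts T) (parcs T) I"
  shows "is_steiner_tree T I \<lparr>pverts = W, parcs = parcs T \<inter> W \<times> W\<rparr>"
proof -
  interpret pair_graph T
    using T by (simp add: fin_tree_def)
  interpret R: tree_relation "pverts T" "parcs T"
    by (rule fin_tree_imp_tree_relation) fact
  define S where "S = \<lparr>pverts = W, parcs = parcs T \<inter> W \<times> W\<rparr>"
  have W: "W \<subseteq> pverts T" "I \<subseteq> W"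
    using I by (auto simp: W_def R.steiner_verts_def)
  interpret S: pair_graph S
    using W finite_subset[OF _ R.finite_V] pair_finite_arcs R.edge_neq R.edge_sym
    by unfold_locales (auto simp: S_def symmetric_def sym_def)
  have sub: "subgraph S T"
    using W by (intro subgraphI) (auto simp: S_def compatible_def intro: S.wf_digraph[unfolded S_def] wf_digraph)
  have conn: "connected S"
    unfolding connected_def
  proof (rule strongly_connectedI)
    show "verts (with_proj (mk_symmetric S)) \<noteq> {}"
      using W I by (auto simp: S_def mk_symmetric_def)
    fix a b
    assume "a \<in> verts (with_proj (mk_symmetric S))" "b \<in> verts (with_proj (mk_symmetric S))"
    then have ab: "a \<in> pverts S" "b \<in> pverts S"
      by (auto simp: mk_symmetric_def)
    then have "(a, b) \<in> (parcs S)\<^sup>*"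
      using R.steiner_verts_connected[OF I] by (simp add: S_def W_def)
    then have "a \<rightarrow>\<^sup>*\<^bsub>S\<^esub> b"
    proof (induction rule: rtrancl_induct)
      case base
      then show ?case using ab by (simp add: S.reachable_refl)
    next
      case (step y z)
      then show ?case
        using S.reachable_adj_trans[of a y z] by simp
    qed
    then show "a \<rightarrow>\<^sup>*\<^bsub>mk_symmetric S\<^esub> b"
      by (rule S.reachable_mk_symmetricI)
  qed
  have "subtree S T"
    using sub conn T subgraph_cycle[OF sub] S.pair_graph unfolding subtree_def fin_tree_def by blast
  moreover have "subgraph S S'" if S': "subtree S' T" "I \<subseteq> pverts S'" for S'
  proof -
    have "pverts S \<subseteq> pverts S'" "parcs S \<subseteq> parcs S'"
      using R.steiner_verts_least[OF subtree_D[OF S'(1)] S'(2)] by (auto simp: S_def W_def)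
    then show ?thesis
      using S' S.wf_digraph by (auto simp: subtree_def subgraph_def compatible_def)
  qed
  ultimately show ?thesis
    using W unfolding is_steiner_tree_def by (simp add: S_def)
qed

lemma infeasible_iff_twins:
  assumes T: "fin_tree T" and I: "I \<subseteq> pverts T"
  shows "infeasible T I \<longleftrightarrow> \<not> tree_relation.twin_free (parcs T) I"
proof -
  interpret R: tree_relation "pverts T" "parcs T"
    by (rule fin_tree_imp_tree_relation) fact
  show ?thesis
  proof
    assume "infeasible T I"
    then obtain S u v where S: "is_steiner_tree T I S"
      and uv: "u \<in> I" "v \<in> I" "u \<noteq> v" "leaf S u" "leaf S v" "parent S u = parent S v"
      unfolding infeasible_def by blast
    have "subtree S T" and IS: "I \<subseteq> pverts S"
      using S by (auto simp: is_steiner_tree_def)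
    note sub = subtree_D[OF this(1)]
    have pendant: "R.pendant I (parent S c) c" if "c \<in> I" "leaf S c" for c
      using R.leaf_of_subtree_pendant[OF sub(1,3) IS that(1)] leaf_parent[OF that(2)] by blast
    have "R.twins I (parent S u) u v"
      using pendant[of u] pendant[of v] uv unfolding R.twins_def by simp
    then show "\<not> R.twin_free I"
      unfolding R.twin_free_def by blast
  next
    assume "\<not> R.twin_free I"
    then obtain w u v where t: "R.twins I w u v"
      unfolding R.twin_free_def by blast
    define S where "S = \<lparr>pverts = R.steiner_verts I, parcs = parcs T \<inter> R.steiner_verts I \<times> R.steiner_verts I\<rparr>"
    have uv: "u \<in> I" "v \<in> I" "u \<noteq> v"
      using t unfolding R.twins_def R.pendant_def by auto
    have S: "is_steiner_tree T I S"
      unfolding S_def using induced_steiner_verts_is_steiner_tree[OF T I] uv by blast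
    have "leaf S c \<and> parent S c = w" if c: "R.pendant I w c" for c
    proof -
      have "c \<in> R.steiner_verts I" "(c, w) \<in> parcs T"
        using c I R.edge_sym unfolding R.pendant_def R.steiner_verts_def by auto
      then have "c \<in> pverts S" "(c, w) \<in> parcs S"
        using R.twins_hub_in_steiner_verts[OF t] by (simp_all add: S_def)
      moreover have "x = w" if "(c, x) \<in> parcs S" for x
        using R.pendant_leaf_of_steiner_verts[OF I c, of x] that by (simp add: S_def)
      ultimately show ?thesis
        using leafI[of c S w] by blast
    qed
    then show "infeasible T I"
      using S uv t unfolding infeasible_def R.twins_def by blast
  qed
qed

theorem theorem3p4:
  fixes T :: "'a pair_pre_digraph"
  assumes "fin_tree T"
  shows "delta_matroid (pverts T) (feasible_sets T)"
proof -
  interpret R: tree_relation "pverts T" "parcs T"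
    by (rule fin_tree_imp_tree_relation) fact
  have feasible: "I \<in> feasible_sets T \<longleftrightarrow> I \<subseteq> pverts T \<and> R.twin_free I" for I
    using infeasible_iff_twins[OF assms] unfolding feasible_sets_def by blast
  have "R.twin_free {}" "R.twin_free {v}" for v
    unfolding R.twin_free_def R.twins_def R.pendant_def by auto
  then have empty: "{} \<in> feasible_sets T"
    and single: "\<And>v. v \<in> pverts T \<Longrightarrow> {v} \<in> feasible_sets T"
    by (simp_all add: feasible)
  have "\<Union> (feasible_sets T) = pverts T"
  proof
    show "\<Union> (feasible_sets T) \<subseteq> pverts T"
      by (auto simp: feasible)
    show "pverts T \<subseteq> \<Union> (feasible_sets T)"
      using single by blast
  qed
  moreover have "\<exists>y\<in>sym_diff A B. sym_diff A {x, y} \<in> feasible_sets T"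
    if A: "A \<in> feasible_sets T" and B: "B \<in> feasible_sets T" and x: "x \<in> sym_diff A B" for A B x
  proof -
    obtain y where "y \<in> sym_diff A B" "R.twin_free (sym_diff A {x, y})"
      using R.twin_free_exchange[of A B x] A B x unfolding feasible by blast
    then show ?thesis
      using A B x by (intro bexI[of _ y]) (auto simp: feasible)
  qed
  ultimately show ?thesis
    using R.finite_V empty unfolding delta_matroid_def by (auto simp: feasible)
qed

end
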